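(* Let $n\ge 1$, $k\ge 2$, $d\ge 1$ be integers, let $\varepsilon>0$, and let $c:(\mathbb{R}^d)^k\to\mathbb{R}$ be a differentiable multiway cost function. Let $\mathscr{M}_c$, $\mathscr{J}_{n,k}$, $\mathscr{P}_\varepsilon(\cdot)$ and the loss $\mathrm{M3G}_{c,\varepsilon}:\mathbb{R}^{k\times n\times d}\to\mathbb{R}$ be as defined in the context. Then: (1) $\mathrm{M3G}_{c,\varepsilon}(\mathscr{X})\ge 0$ for every $\mathscr{X}\in\mathbb{R}^{k\times n\times d}$. (2) For every $\mathscr{X}\in\mathbb{R}^{k\times n\times d}$, the gradient of $\mathrm{M3G}_{c,\varepsilon}$ at $\mathscr{X}$ is $$\nabla \mathrm{M3G}_{c,\varepsilon}(\mathscr{X}) = \partial \mathscr{M}_c(\mathscr{X})^*\left[\mathscr{J}_{n,k}-\mathscr{P}_\varepsilon(\mathscr{M}_c(\mathscr{X}))\right]\in\mathbb{R}^{k\times n\times d}.$$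
   Context: Tensors: $\mathcal{T}_{n,k}:=\mathbb{R}^{n\times\cdots\times n}$ ($k$ factors) is the space of real tensors $\mathscr{P}=(\mathscr{P}_{i_1\dots i_k})_{1\le i_1,\dots,i_k\le n}$, with inner product $\langle \mathscr{A},\mathscr{B}\rangle=\sum_{i_1,\dots,i_k}\mathscr{A}_{i_1\dots i_k}\mathscr{B}_{i_1\dots i_k}$. For $1\le \ell\le k$, the $\ell$-th marginal $\mathrm{m}_\ell(\mathscr{P})\in\mathbb{R}^n$ is obtained by summing $\mathscr{P}$ over all indices except $i_\ell$. Let $\mathds{1}_n\in\mathbb{R}^n$ be the all-ones vector. The polytope of $k$-polystochastic tensors is $$\mathcal{B}_{n,k}:=\{\mathscr{P}\in\mathcal{T}_{n,k} : \mathscr{P}\ge 0 \text{ entrywise, and } \mathrm{m}_\ell(\mathscr{P})=\mathds{1}_n/n \text{ for all } \ell\le k\}.$$ Ground-truth tensor: $\mathscr{J}_{n,k}\in\mathcal{T}_{n,k}$ has entries $[\mathscr{J}_{n,k}]_{i_1\dots i_k}=\tfrac1n$ if $i_1=\dots=i_k$ and $0$ otherwise. Regularized objective: for $\mathscr{P}\in\mathcal{T}_{n,k}$ with nonnegative entries and $\mathscr{C}\in\mathcal{T}_{n,k}$, $$h_{k,\varepsilon}(\mathscr{P},\mathscr{C}):=\langle\mathscr{P},\mathscr{C}\rangle+\varepsilon\langle\mathscr{P},\log\mathscr{P}-1\rangle,$$ with $\log$ applied entrywise and the convention $0\log 0=0$. Let $\mathscr{P}_\varepsilon(\mathscr{C}):=\operatorname{arg\,min}_{\mathscr{P}\in\mathcal{B}_{n,k}}h_{k,\varepsilon}(\mathscr{P},\mathscr{C})$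 be the minimizer (unique since $\varepsilon>0$). Cost tensor: a point $\mathscr{X}\in\mathbb{R}^{k\times n\times d}$ is a family of vectors $\mathbf{x}_i^\ell\in\mathbb{R}^d$, $1\le \ell\le k$, $1\le i\le n$ (the $\ell$-th view of the $i$-th object). Define $\mathscr{M}_c:\mathbb{R}^{k\times n\times d}\to\mathcal{T}_{n,k}$ by $[\mathscr{M}_c(\mathscr{X})]_{i_1\dots i_k}=c(\mathbf{x}_{i_1}^1,\dots,\mathbf{x}_{i_k}^k)$. Its differential at $\mathscr{X}$ is the linear map $\partial\mathscr{M}_c(\mathscr{X}):\mathbb{R}^{k\times n\times d}\to\mathcal{T}_{n,k}$, and $\partial\mathscr{M}_c(\mathscr{X})^*:\mathcal{T}_{n,k}\to\mathbb{R}^{k\times n\times d}$ is its adjoint for the Euclidean (entrywise) inner products. Multi-marginal matching gap: $$\mathrm{M3G}_{c,\varepsilon}(\mathscr{X}):=h_{k,\varepsilon}(\mathscr{J}_{n,k},\mathscr{M}_c(\mathscr{X}))-\inf_{\mathscr{P}\in\mathcal{B}_{n,k}}h_{k,\varepsilon}(\mathscr{P},\mathscr{M}_c(\mathscr{X})).$$ *)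

theory Defs
  imports "HOL-Analysis.Analysis"
begin

text \<open>
  The index types \<open>'n\<close> (objects), \<open>'k\<close> (views) and \<open>'d\<close> (coordinates) have cardinality
  \<open>n\<close>, \<open>k\<close> and \<open>d\<close>. A multi-index \<open>(i\<^sub>1, \<dots>, i\<^sub>k)\<close> is a function \<open>i :: 'k \<Rightarrow> 'n\<close>, so tensors
  live in the Euclidean space \<open>real ^ ('k \<Rightarrow> 'n)\<close>, whose inner product is the entrywise one.
  In a point \<open>X :: real ^ 'd ^ 'n ^ 'k\<close>, the vector \<open>X $ l $ i\<close> is the \<open>l\<close>-th view of the
  \<open>i\<close>-th object.
\<close>

type_synonym ('n, 'k) tensor = "real ^ ('k \<Rightarrow> 'n)"

definition marginal :: "'k::finite \<Rightarrow> ('n::finite, 'k) tensor \<Rightarrow> real ^ 'n" where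
  "marginal l P = (\<chi> j. \<Sum>i | i l = j. P $ i)"

definition polystochastic :: "('n::finite, 'k::finite) tensor set" where
  "polystochastic =
     {P. (\<forall>i. P $ i \<ge> 0) \<and> (\<forall>l. marginal l P = (\<chi> j. 1 / real CARD('n)))}"

definition ground_truth :: "('n::finite, 'k::finite) tensor" where
  "ground_truth = (\<chi> i. if \<forall>l m. i l = i m then 1 / real CARD('n) else 0)"

text \<open>
  The convention \<open>0 log 0 = 0\<close> holds because \<^term>\<open>ln (0::real)\<close> is a real number, so its
  product with \<open>0\<close> vanishes.
  The objective is only meaningful for entrywise nonnegative \<open>P\<close>.
\<close>

definition reg_objective ::
    "real \<Rightarrow> ('n::finite, 'k::finite) tensor \<Rightarrow> ('n, 'k) tensor \<Rightarrow> real" where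
  "reg_objective \<epsilon> P C = P \<bullet> C + \<epsilon> * (P \<bullet> (\<chi> i. ln (P $ i) - 1))"

text \<open>For \<open>\<epsilon> > 0\<close> the minimizer exists and is unique.\<close>

definition opt_tensor :: "real \<Rightarrow> ('n::finite, 'k::finite) tensor \<Rightarrow> ('n, 'k) tensor" where
  "opt_tensor \<epsilon> C = arg_min_on (\<lambda>P. reg_objective \<epsilon> P C) polystochastic"

definition cost_tensor ::
    "(real ^ 'd ^ 'k \<Rightarrow> real) \<Rightarrow> real ^ 'd ^ 'n ^ 'k \<Rightarrow> ('n::finite, 'k::finite) tensor" where
  "cost_tensor c X = (\<chi> i. c (\<chi> l. X $ l $ i l))"

definition M3G :: "(real ^ 'd ^ 'k \<Rightarrow> real) \<Rightarrow> real \<Rightarrow> real ^ 'd ^ 'n ^ 'k \<Rightarrow> real" where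
  "M3G c \<epsilon> X =
     reg_objective \<epsilon> ground_truth (cost_tensor c X)
     - (INF P \<in> polystochastic. reg_objective \<epsilon> P (cost_tensor c X))"

end

theory Submission
  imports Defs "HOL-Real_Asymp.Real_Asymp"
begin

text \<open>
  The infimum over the polytope is a concave function of the cost tensor. By strict convexity of
  \<open>t ln t\<close> it is attained at a single point, so Danskin's envelope theorem shows that it is
  differentiable with gradient the minimizer. The other term of the loss is affine in the cost
  tensor with gradient the ground truth, and the chain rule through the cost tensor concludes.
\<close>

section \<open>Envelope theorem for infima of affine functions over a compact set\<close>

lemma INF_eq_of_minimizer:
  fixes f :: "'a \<Rightarrow> real"
  assumes "x \<in> S" and "\<And>y. y \<in> S \<Longrightarrow> f x \<le> f y"
  shows "(INF y \<in> S. f y) = f x"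
  using assms by (intro cInf_eq_minimum) auto

text \<open>If \<open>m D\<close> is a minimizer for \<open>D\<close>, testing \<open>p\<close> at
  \<open>D\<close> and \<open>m D\<close> at \<open>C\<close> traps the linearization error between
  \<open>(m D - p) \<bullet> (D - C)\<close> and 0. It is therefore o(norm (D - C)) once
  \<open>m D\<close> tends to \<open>p\<close>, which compactness and uniqueness at \<open>C\<close>
  provide.\<close>

lemma danskin_has_derivative:
  fixes g :: "'a::euclidean_space \<Rightarrow> real"
  assumes S: "compact S" and g: "continuous_on S g" and p: "p \<in> S"
    and uniq: "\<And>q. q \<in> S \<Longrightarrow> q \<noteq> p \<Longrightarrow> p \<bullet> C + g p < q \<bullet> C + g q"
  shows "((\<lambda>D. INF q \<in> S. q \<bullet> D + g q) has_derivative (\<lambda>H. p \<bullet> H)) (at C)"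
proof -
  let ?F = "\<lambda>D q. q \<bullet> D + g q"
  let ?\<phi> = "\<lambda>D. INF q \<in> S. ?F D q"
  have cont: "continuous_on T (?F D)" if "T \<subseteq> S" for D T
    using that by (intro continuous_intros continuous_on_subset[OF g])
  have min_ex: "\<exists>q\<in>S. \<forall>r\<in>S. ?F D q \<le> ?F D r" for D
    using continuous_attains_inf[OF S _ cont] p by blast
  \<comment> \<open>An arbitrary selection of minimizers; uniqueness is assumed only at
    \<open>C\<close>.\<close>
  obtain m where m: "\<And>D. m D \<in> S" "\<And>D r. r \<in> S \<Longrightarrow> ?F D (m D) \<le> ?F D r"
    using min_ex by metis
  have \<phi>: "?\<phi> D = ?F D (m D)" for D
    using m by (intro INF_eq_of_minimizer) auto
  have \<phi>_le: "?\<phi> D \<le> ?F D q" if "q \<in> S" for D q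
    using \<phi> m that by metis
  have \<phi>C: "?\<phi> C = ?F C p"
    using p uniq by (intro INF_eq_of_minimizer) force+
  obtain R where R: "R > 0" "\<And>q. q \<in> S \<Longrightarrow> norm q \<le> R"
    using compact_imp_bounded[OF S] by (auto simp: bounded_pos)
  have inner_bound: "\<bar>q \<bullet> H\<bar> \<le> R * norm H" if "q \<in> S" for q H
    using Cauchy_Schwarz_ineq2[of q H] R(2)[OF that]
    by (meson mult_right_mono norm_ge_zero order_trans)
  \<comment> \<open>Continuity of the selection at \<open>C\<close>: outside the ball around
    \<open>p\<close> the objective at \<open>C\<close> exceeds its minimum by a fixed gap, which a
    small change of \<open>D\<close> cannot close.\<close>
  have near: "\<exists>d>0. \<forall>D. norm (D - C) < d \<longrightarrow> norm (m D - p) < e" if e: "e > 0" for e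
  proof (cases "S - ball p e = {}")
    case True
    then have "norm (m D - p) < e" for D
      using m(1)[of D] by (auto simp: dist_norm norm_minus_commute)
    then show ?thesis by (intro exI[of _ 1]) auto
  next
    case False
    have "compact (S - ball p e)"
      using S by (simp add: compact_diff)
    then obtain q where q: "q \<in> S - ball p e" "\<And>r. r \<in> S - ball p e \<Longrightarrow> ?F C q \<le> ?F C r"
      using continuous_attains_inf[OF _ False cont] by blast
    define gap where "gap = ?F C q - ?F C p"
    have gap: "gap > 0"
      using q(1) uniq[of q] e by (cases "q = p") (auto simp: gap_def)
    have "norm (m D - p) < e" if D: "norm (D - C) < gap / (2 * R)" for D
    proof (rule ccontr)
      assume "\<not> norm (m D - p) < e"
      then have "m D \<in> S - ball p e"
        using m(1) by (auto simp: dist_norm norm_minus_commute)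
      then have "gap \<le> ?F C (m D) - ?F C p"
        using q(2) by (simp add: gap_def)
      \<comment> \<open>The bracket is nonpositive because \<open>m D\<close> is optimal for
        \<open>D\<close>. Each remaining term is at most \<open>R * norm (D - C)\<close>, hence the
        radius \<open>gap / (2 * R)\<close>.\<close>
      also have "\<dots> = (?F D (m D) - ?F D p) + p \<bullet> (D - C) - m D \<bullet> (D - C)"
        by (simp add: inner_diff_right)
      also have "\<dots> \<le> 2 * R * norm (D - C)"
        using m(2)[OF p, of D] inner_bound[OF p, of "D - C"] inner_bound[OF m(1), of D "D - C"]
        by linarith
      also have "\<dots> < gap"
        using D R(1) by (simp add: field_simps)
      finally show False by simp
    qed
    then show ?thesis
      using gap R(1) by (intro exI[of _ "gap / (2 * R)"]) auto
  qed
  have bound: "\<bar>?\<phi> D - ?\<phi> C - p \<bullet> (D - C)\<bar> \<le> norm (m D - p) * norm (D - C)" for D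
  proof -
    have "?\<phi> D \<le> ?\<phi> C + p \<bullet> (D - C)"
      using \<phi>_le[OF p, of D] unfolding \<phi>C by (simp add: inner_diff_right)
    moreover have "?\<phi> D = ?F C (m D) + m D \<bullet> (D - C)"
      unfolding \<phi> by (simp add: inner_diff_right)
    moreover have "?\<phi> C \<le> ?F C (m D)"
      by (rule \<phi>_le[OF m(1)])
    moreover have "\<bar>(m D - p) \<bullet> (D - C)\<bar> \<le> norm (m D - p) * norm (D - C)"
      by (rule Cauchy_Schwarz_ineq2)
    ultimately show ?thesis
      by (simp add: inner_diff_left)
  qed
  show ?thesis
    unfolding has_derivative_at_alt
  proof (intro conjI allI impI)
    show "bounded_linear (\<lambda>H. p \<bullet> H)" by (rule bounded_linear_inner_right)
  next
    fix e :: real assume "e > 0"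
    then obtain d where d: "d > 0" "\<And>D. norm (D - C) < d \<Longrightarrow> norm (m D - p) < e"
      using near by blast
    have "norm (?\<phi> D - ?\<phi> C - p \<bullet> (D - C)) \<le> e * norm (D - C)" if "norm (D - C) < d" for D
      using bound[of D] mult_right_mono[OF less_imp_le[OF d(2)[OF that]] norm_ge_zero[of "D - C"]]
      unfolding real_norm_def by linarith
    then show "\<exists>d>0. \<forall>D. norm (D - C) < d \<longrightarrow>
        norm (?\<phi> D - ?\<phi> C - p \<bullet> (D - C)) \<le> e * norm (D - C)"
      using d(1) by blast
  qed
qed

section \<open>Continuity and strict convexity of t ln t on the closed half-line\<close>

lemma continuous_on_mult_ln: "continuous_on {0..} (\<lambda>t::real. t * ln t)"
  unfolding continuous_on_eq_continuous_within
proof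
  fix x :: real assume "x \<in> {0..}"
  \<comment> \<open>At 0 the logarithm has no limit, so continuity there is the one-sided limit t ln
    t -> 0, which agrees with the value \<open>0 * ln 0 = 0\<close>.\<close>
  then consider "x = 0" | "x > 0" by force
  then show "continuous (at x within {0..}) (\<lambda>t. t * ln t)"
  proof cases
    case 1
    have "((\<lambda>t::real. t * ln t) \<longlongrightarrow> 0) (at_right 0)"
      by real_asymp
    moreover have "at (0::real) within {0..} = at_right 0"
      by (simp add: at_within_Ici_at_right)
    ultimately show ?thesis
      using 1 by (simp add: continuous_within)
  next
    case 2
    then show ?thesis by (intro continuous_intros) auto
  qed
qed

text \<open>The left-hand side is the tangent line of t ln t at \<open>m\<close>, evaluated at
  \<open>a\<close>. For \<open>a > 0\<close> the claim is ln x \<le> x - 1 at x =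
  \<open>m / a\<close>, with equality only for x = 1.\<close>

lemma mult_ln_tangent:
  fixes a m :: real
  assumes "a \<ge> 0" and "m > 0"
  shows "a * ln m + a - m \<le> a * ln a"
    and "a \<noteq> m \<Longrightarrow> a * ln m + a - m < a * ln a"
proof -
  have strict: "a * ln m + a - m < a * ln a" if "a \<noteq> m"
  proof (cases "a = 0")
    case False
    with assms have a: "a > 0" by simp
    have "ln (m / a) < m / a - 1"
      using ln_le_minus_one[of "m / a"] ln_eq_minus_one[of "m / a"] a assms(2) that
      by (fastforce simp: order_less_le)
    then have "a * ln (m / a) < a * (m / a - 1)"
      using a by simp
    then show ?thesis
      using a assms(2) by (simp add: ln_div algebra_simps)
  qed (use assms in simp)
  then show "a \<noteq> m \<Longrightarrow> a * ln m + a - m < a * ln a" .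
  show "a * ln m + a - m \<le> a * ln a"
    using strict by (cases "a = m") auto
qed

text \<open>Add the tangent inequalities at \<open>m\<close> for \<open>a\<close> and
  \<open>b\<close>: the linear terms cancel since \<open>a + b = 2 * m\<close>. If
  \<open>a \<noteq> b\<close>, then \<open>m > 0\<close>, so the tangent exists.\<close>

lemma mult_ln_midpoint:
  fixes a b m :: real
  assumes "a \<ge> 0" and "b \<ge> 0" and ab: "a + b = 2 * m"
  shows "2 * (m * ln m) \<le> a * ln a + b * ln b"
    and "a \<noteq> b \<Longrightarrow> 2 * (m * ln m) < a * ln a + b * ln b"
proof -
  have strict: "2 * (m * ln m) < a * ln a + b * ln b" if "a \<noteq> b"
  proof -
    have "m > 0" "a \<noteq> m"
      using assms that by auto
    moreover have "a * ln m + b * ln m = 2 * (m * ln m)"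
      using ab by (simp flip: distrib_right)
    ultimately show ?thesis
      using mult_ln_tangent(2)[of a m] mult_ln_tangent(1)[of b m] assms by linarith
  qed
  then show "a \<noteq> b \<Longrightarrow> 2 * (m * ln m) < a * ln a + b * ln b" .
  show "2 * (m * ln m) \<le> a * ln a + b * ln b"
    using strict ab by (cases "a = b") auto
qed

section \<open>The polytope: a member, compactness, closure under midpoints\<close>

lemma polystochastic_iff:
  fixes P :: "('n::finite, 'k::finite) tensor"
  shows "P \<in> polystochastic \<longleftrightarrow>
    (\<forall>i. P $ i \<ge> 0) \<and> (\<forall>l j. (\<Sum>i | i l = j. P $ i) = 1 / real CARD('n))"
  by (auto simp: polystochastic_def marginal_def vec_eq_iff)

lemma ground_truth_polystochastic:
  "(ground_truth :: ('n::finite, 'k::finite) tensor) \<in> polystochastic"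
proof -
  have "(\<Sum>i | i l = j. (ground_truth :: ('n, 'k) tensor) $ i) = 1 / real CARD('n)"
    for l :: 'k and j :: 'n
  proof -
    have "(\<Sum>i | i l = j. (ground_truth :: ('n, 'k) tensor) $ i)
        = (\<Sum>i | i l = j. if i = (\<lambda>_. j) then 1 / real CARD('n) else 0)"
      by (intro sum.cong) (auto simp: ground_truth_def fun_eq_iff)
    then show ?thesis by (simp add: sum.delta)
  qed
  then show ?thesis
    by (simp add: polystochastic_iff) (simp add: ground_truth_def)
qed

lemma compact_polystochastic: "compact (polystochastic :: ('n::finite, 'k::finite) tensor set)"
  unfolding compact_eq_bounded_closed
proof
  have "P $ i \<le> 1" if "P \<in> polystochastic" for P :: "('n, 'k) tensor" and i
  proof -
    \<comment> \<open>Any view serves: an entry is at most the marginal sum containing it.\<close>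
    fix l :: 'k
    have "P $ i \<le> (\<Sum>i' | i' l = i l. P $ i')"
      using that by (intro member_le_sum) (auto simp: polystochastic_iff)
    also have "\<dots> \<le> 1"
      using that by (simp add: polystochastic_iff)
    finally show ?thesis .
  qed
  then have "(polystochastic :: ('n, 'k) tensor set) \<subseteq> cbox 0 1"
    by (auto simp: mem_box_cart polystochastic_iff)
  then show "bounded (polystochastic :: ('n, 'k) tensor set)"
    using bounded_cbox bounded_subset by blast
  have "closed {P :: ('n, 'k) tensor. (\<forall>i. P $ i \<ge> 0) \<and>
      (\<forall>l j. (\<Sum>i | i l = j. P $ i) = 1 / real CARD('n))}"
    by (intro closed_Collect_conj closed_Collect_all closed_Collect_le closed_Collect_eq
        continuous_intros)
  then show "closed (polystochastic :: ('n, 'k) tensor set)"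
    by (simp add: polystochastic_iff[symmetric])
qed

lemma midpoint_polystochastic:
  assumes "P \<in> polystochastic" and "Q \<in> polystochastic"
  shows "midpoint P Q \<in> polystochastic"
  using assms
  by (auto simp: polystochastic_iff midpoint_def sum.distrib sum_distrib_left[symmetric]
      distrib_left sum_divide_distrib[symmetric])

section \<open>Entropy and the unique minimizer\<close>

definition entropic :: "('n::finite, 'k::finite) tensor \<Rightarrow> real" where
  "entropic P = (\<Sum>i\<in>UNIV. P $ i * ln (P $ i) - P $ i)"

text \<open>Separates off a summand independent of \<open>C\<close>, giving the shape
  \<open>q \<bullet> D + g q\<close> required by \<open>danskin_has_derivative\<close>.\<close>

lemma reg_objective_entropic: "reg_objective \<epsilon> P C = P \<bullet> C + \<epsilon> * entropic P"
  by (simp add: reg_objective_def entropic_def inner_vec_def algebra_simps)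

lemma continuous_on_entropic:
  "continuous_on (polystochastic :: ('n::finite, 'k::finite) tensor set) entropic"
  unfolding entropic_def
proof (intro continuous_on_sum continuous_on_diff)
  fix i :: "'k \<Rightarrow> 'n"
  show "continuous_on polystochastic (\<lambda>P :: ('n, 'k) tensor. P $ i * ln (P $ i))"
    by (rule continuous_on_compose2[OF continuous_on_mult_ln])
      (auto intro!: continuous_intros simp: polystochastic_iff)
qed (intro continuous_intros)

text \<open>Convexity holds entry by entry, and an entry where \<open>P\<close> and \<open>Q\<close>
  differ makes the sum strict.\<close>

lemma entropic_midpoint:
  fixes P Q :: "('n::finite, 'k::finite) tensor"
  assumes "P \<in> polystochastic" and "Q \<in> polystochastic" and "P \<noteq> Q"
  shows "2 * entropic (midpoint P Q) < entropic P + entropic Q"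
proof -
  have nn: "P $ i \<ge> 0" "Q $ i \<ge> 0" for i
    using assms by (auto simp: polystochastic_iff)
  have mid: "P $ i + Q $ i = 2 * midpoint P Q $ i" for i
    by (simp add: midpoint_def)
  obtain i where i: "P $ i \<noteq> Q $ i"
    using assms(3) by (auto simp: vec_eq_iff)
  let ?l = "\<lambda>j. 2 * (midpoint P Q $ j * ln (midpoint P Q $ j) - midpoint P Q $ j)"
  let ?r = "\<lambda>j. (P $ j * ln (P $ j) - P $ j) + (Q $ j * ln (Q $ j) - Q $ j)"
  have "?l j \<le> ?r j" for j
    using mult_ln_midpoint(1)[OF nn mid, of j] mid[of j] by (simp add: right_diff_distrib)
  moreover have "?l i < ?r i"
    using mult_ln_midpoint(2)[OF nn mid i] mid[of i] by (simp add: right_diff_distrib)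
  ultimately have "sum ?l UNIV < sum ?r UNIV"
    by (intro sum_strict_mono_ex1) auto
  then show ?thesis
    by (simp add: entropic_def sum_distrib_left sum.distrib)
qed

text \<open>Existence comes from compactness. A second minimizer is excluded because its midpoint
  with the first would have a smaller objective.\<close>

lemma opt_tensor_minimizes:
  fixes C :: "('n::finite, 'k::finite) tensor"
  assumes "\<epsilon> > 0"
  shows "opt_tensor \<epsilon> C \<in> polystochastic"
    and "\<And>Q. Q \<in> polystochastic \<Longrightarrow> Q \<noteq> opt_tensor \<epsilon> C \<Longrightarrow>
          reg_objective \<epsilon> (opt_tensor \<epsilon> C) C < reg_objective \<epsilon> Q C"
proof -
  let ?F = "\<lambda>P. reg_objective \<epsilon> P C"
  have "continuous_on polystochastic ?F"
    unfolding reg_objective_entropic by (intro continuous_intros continuous_on_entropic)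
  then obtain P :: "('n, 'k) tensor" where P: "P \<in> polystochastic"
    "\<And>Q. Q \<in> polystochastic \<Longrightarrow> ?F P \<le> ?F Q"
    using continuous_attains_inf[OF compact_polystochastic] ground_truth_polystochastic by blast
  then have "is_arg_min ?F (\<lambda>P. P \<in> polystochastic) P"
    by (auto simp: is_arg_min_linorder)
  \<comment> \<open>\<open>opt_tensor\<close> is a Hilbert choice, so it inherits minimality only
    after some minimizer is exhibited.\<close>
  then have "is_arg_min ?F (\<lambda>P. P \<in> polystochastic) (opt_tensor \<epsilon> C)"
    unfolding opt_tensor_def arg_min_on_def arg_min_def by (rule someI)
  then have opt: "opt_tensor \<epsilon> C \<in> polystochastic"
    "\<And>Q. Q \<in> polystochastic \<Longrightarrow> ?F (opt_tensor \<epsilon> C) \<le> ?F Q"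
    by (auto simp: is_arg_min_linorder)
  then show "opt_tensor \<epsilon> C \<in> polystochastic" by blast
  fix Q assume Q: "Q \<in> polystochastic" "Q \<noteq> opt_tensor \<epsilon> C"
  let ?M = "midpoint (opt_tensor \<epsilon> C) Q"
  have "2 * (?M \<bullet> C) = opt_tensor \<epsilon> C \<bullet> C + Q \<bullet> C"
    by (simp add: midpoint_def inner_add_left)
  moreover have "\<epsilon> * (2 * entropic ?M) < \<epsilon> * (entropic (opt_tensor \<epsilon> C) + entropic Q)"
    using entropic_midpoint[OF opt(1) Q(1)] Q(2) assms by simp
  ultimately have "2 * ?F ?M < ?F (opt_tensor \<epsilon> C) + ?F Q"
    by (simp add: reg_objective_entropic algebra_simps)
  then show "?F (opt_tensor \<epsilon> C) < ?F Q"
    using opt(2)[OF midpoint_polystochastic[OF opt(1) Q(1)]] by linarith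
qed

section \<open>Derivatives and the two claims about the loss\<close>

lemma has_derivative_INF_reg_objective:
  fixes C :: "('n::finite, 'k::finite) tensor"
  assumes "\<epsilon> > 0"
  shows "((\<lambda>D. INF P \<in> polystochastic. reg_objective \<epsilon> P D) has_derivative
          (\<lambda>H. opt_tensor \<epsilon> C \<bullet> H)) (at C)"
  unfolding reg_objective_entropic
  using opt_tensor_minimizes[OF assms]
  by (intro danskin_has_derivative compact_polystochastic continuous_intros continuous_on_entropic)
    (auto simp: reg_objective_entropic)

text \<open>Each entry is \<open>c\<close> composed with the linear map selecting the views
  \<open>X $ l $ i l\<close>.\<close>

lemma differentiable_cost_tensor:
  fixes c :: "real ^ 'd ^ 'k \<Rightarrow> real" and X :: "real ^ 'd ^ 'n ^ 'k"
  assumes "c differentiable_on UNIV"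
  shows "cost_tensor c differentiable (at X)"
proof -
  have "(\<lambda>X. cost_tensor c X $ i) differentiable (at X)" for i :: "'k \<Rightarrow> 'n"
  proof -
    have "linear (\<lambda>X :: real ^ 'd ^ 'n ^ 'k. \<chi> l. X $ l $ i l)"
      by (rule linearI) (simp_all add: vec_eq_iff)
    then have "(\<lambda>X :: real ^ 'd ^ 'n ^ 'k. \<chi> l. X $ l $ i l) differentiable (at X)"
      by (rule linear_imp_differentiable)
    moreover have "c differentiable (at (\<chi> l. X $ l $ i l))"
      using assms by (simp add: differentiable_on_def)
    ultimately have "(c \<circ> (\<lambda>X. \<chi> l. X $ l $ i l)) differentiable (at X)"
      by (rule differentiable_chain_at)
    then show ?thesis
      by (simp add: cost_tensor_def o_def)
  qed
  then show ?thesis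
    by (subst differentiable_componentwise_within) (auto simp: Basis_vec_def inner_axis)
qed

text \<open>The ground truth is itself a competitor in the infimum.\<close>

lemma M3G_nonneg:
  assumes "\<epsilon> > 0"
  shows "M3G c \<epsilon> X \<ge> 0"
proof -
  let ?C = "cost_tensor c X"
  have "(INF P \<in> polystochastic. reg_objective \<epsilon> P ?C) = reg_objective \<epsilon> (opt_tensor \<epsilon> ?C) ?C"
    using opt_tensor_minimizes[OF assms, where C = ?C]
    by (intro INF_eq_of_minimizer) force+
  also have "\<dots> \<le> reg_objective \<epsilon> ground_truth ?C"
    using opt_tensor_minimizes(2)[OF assms ground_truth_polystochastic]
    by (cases "ground_truth = opt_tensor \<epsilon> ?C") force+
  finally show ?thesis
    by (simp add: M3G_def)
qed

lemma GDERIV_M3G: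
  assumes "\<epsilon> > 0" and "cost_tensor c differentiable (at X)"
  shows "GDERIV (M3G c \<epsilon>) X :>
    adjoint (frechet_derivative (cost_tensor c) (at X))
      (ground_truth - opt_tensor \<epsilon> (cost_tensor c X))"
proof -
  let ?C = "cost_tensor c" and ?D = "frechet_derivative (cost_tensor c) (at X)"
  let ?G = "ground_truth - opt_tensor \<epsilon> (?C X)"
  have D: "(?C has_derivative ?D) (at X)"
    using assms(2) by (simp add: frechet_derivative_works)
  \<comment> \<open>In the first term the entropy of the ground truth is constant in
    \<open>C\<close>; only the inner product contributes.\<close>
  have "((\<lambda>C. reg_objective \<epsilon> ground_truth C - (INF P \<in> polystochastic. reg_objective \<epsilon> P C))
      has_derivative (\<lambda>H. ground_truth \<bullet> H - opt_tensor \<epsilon> (?C X) \<bullet> H)) (at (?C X))"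
    using has_derivative_INF_reg_objective[OF assms(1)]
    by (auto simp: reg_objective_def intro!: derivative_eq_intros)
  from has_derivative_compose[OF D this]
  have "(M3G c \<epsilon> has_derivative (\<lambda>H. ?D H \<bullet> ?G)) (at X)"
    by (simp add: M3G_def[abs_def] inner_diff_right inner_commute)
  \<comment> \<open>The adjoint turns the pairing of \<open>?D H\<close> with \<open>?G\<close> into
    a pairing with \<open>H\<close>, exposing the gradient.\<close>
  then show ?thesis
    using adjoint_works[OF has_derivative_linear[OF D]]
    by (simp add: gderiv_def)
qed

theorem proposition3p2:
  fixes c :: "real ^ 'd ^ 'k \<Rightarrow> real"
    and \<epsilon> :: real
  assumes "CARD('k) \<ge> 2"
    and "\<epsilon> > 0"
    and "c differentiable_on UNIV"
  shows "(\<forall>X :: real ^ 'd ^ 'n ^ 'k. M3G c \<epsilon> X \<ge> 0) \<and>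
         (\<forall>X :: real ^ 'd ^ 'n ^ 'k.
            GDERIV (M3G c \<epsilon>) X :>
              adjoint (frechet_derivative (cost_tensor c) (at X))
                (ground_truth - opt_tensor \<epsilon> (cost_tensor c X)))"
  using assms(2,3) by (simp add: M3G_nonneg GDERIV_M3G differentiable_cost_tensor)

end
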